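(* Let $G$ be any finite simple graph with vertex set $\{x_1,\ldots,x_n\}$, and let $k_1,\ldots,k_n$ be integers with $k_i\ge 2$. Let $\widetilde G$ be the graph with vertex set $\{x_{i,j}: 1\le i\le n,\ 1\le j\le k_i\}$ and edge set $\{\{x_{i,1},x_{j,1}\}: \{x_i,x_j\}\in E(G)\}\cup\bigcup_{i=1}^n\{\{x_{i,j},x_{i,l}\}: 1\le j<l\le k_i\}$ (i.e. a clique of size $k_i$ is attached at each $x_i$). Then $\widetilde G$ is vertex decomposable and $\mathrm{Shed}(\widetilde G)$ is a dominating set of $\widetilde G$.
   Context: For a graph $G=(V,E)$ and $x\in V$, $G\setminus x$ is the graph obtained by deleting $x$ and its incident edges; $N(x)$ is the set of neighbours of $x$, $N[x]=N(x)\cup\{x\}$, and $G\setminus N[x]$ is obtained by deleting all vertices of $N[x]$ and their incident edges. A graph is well-covered if all its maximal independent sets have the same cardinality. A graph $G$ is vertex decomposable if $G$ is well-covered and either (i) $G$ has no edges (possibly no vertices), or (ii) there is a vertex $x$ such that both $G\setminus x$ and $G\setminus N[x]$ are vertex decomposable. For a vertex decomposable graph $G$, $\mathrm{Shed}(G)$ is the set of vertices $x$ such that $G\setminus x$ and $G\setminus N[x]$ are both vertex decomposable. A set $D\subseteq V$ is dominating if every vertex of $V\setminus D$ is adjacent to a vertex of $D$. *)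

theory Defs
  imports Main
begin

record 'a ugraph =
  verts :: "'a set"
  edges :: "'a set set"

definition fin_simple_graph :: "'a ugraph \<Rightarrow> bool" where
  "fin_simple_graph G \<longleftrightarrow>
     finite (verts G) \<and> (\<forall>e\<in>edges G. e \<subseteq> verts G \<and> card e = 2)"

definition delete_verts :: "'a ugraph \<Rightarrow> 'a set \<Rightarrow> 'a ugraph" where
  "delete_verts G S = \<lparr>verts = verts G - S, edges = {e \<in> edges G. e \<inter> S = {}}\<rparr>"

definition nbhd :: "'a ugraph \<Rightarrow> 'a \<Rightarrow> 'a set" where
  "nbhd G x = {y \<in> verts G. {x, y} \<in> edges G}"

definition closed_nbhd :: "'a ugraph \<Rightarrow> 'a \<Rightarrow> 'a set" where
  "closed_nbhd G x = nbhd G x \<union> {x}"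

definition independent_set :: "'a ugraph \<Rightarrow> 'a set \<Rightarrow> bool" where
  "independent_set G S \<longleftrightarrow> S \<subseteq> verts G \<and> (\<forall>u\<in>S. \<forall>v\<in>S. {u, v} \<notin> edges G)"

definition maximal_independent_set :: "'a ugraph \<Rightarrow> 'a set \<Rightarrow> bool" where
  "maximal_independent_set G S \<longleftrightarrow>
     independent_set G S \<and> (\<forall>T. independent_set G T \<and> S \<subseteq> T \<longrightarrow> T = S)"

text \<open>Only meaningful for finite graphs, since \<open>card\<close> is 0 on infinite sets.\<close>

definition well_covered :: "'a ugraph \<Rightarrow> bool" where
  "well_covered G \<longleftrightarrow>
     (\<forall>S T. maximal_independent_set G S \<and> maximal_independent_set G T \<longrightarrow> card S = card T)"

inductive vertex_decomposable :: "'a ugraph \<Rightarrow> bool" where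
  no_edges: "well_covered G \<Longrightarrow> edges G = {} \<Longrightarrow> vertex_decomposable G"
| shed: "well_covered G \<Longrightarrow> x \<in> verts G \<Longrightarrow>
     vertex_decomposable (delete_verts G {x}) \<Longrightarrow>
     vertex_decomposable (delete_verts G (closed_nbhd G x)) \<Longrightarrow>
     vertex_decomposable G"

definition Shed :: "'a ugraph \<Rightarrow> 'a set" where
  "Shed G = {x \<in> verts G. vertex_decomposable (delete_verts G {x}) \<and>
                           vertex_decomposable (delete_verts G (closed_nbhd G x))}"

definition dominating_set :: "'a ugraph \<Rightarrow> 'a set \<Rightarrow> bool" where
  "dominating_set G D \<longleftrightarrow>
     D \<subseteq> verts G \<and> (\<forall>v \<in> verts G - D. \<exists>d\<in>D. {v, d} \<in> edges G)"

text \<open>The vertex \<open>(x, j)\<close> is the \<open>j\<close>-th vertex of the clique attached at \<open>x\<close>; the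
  copy of \<open>x\<close> itself is \<open>(x, 1)\<close>.\<close>

definition attach_cliques :: "'a ugraph \<Rightarrow> ('a \<Rightarrow> nat) \<Rightarrow> ('a \<times> nat) ugraph" where
  "attach_cliques G k =
     \<lparr>verts = {(x, j). x \<in> verts G \<and> 1 \<le> j \<and> j \<le> k x},
      edges = {{(x, 1), (y, 1)} | x y. {x, y} \<in> edges G} \<union>
              (\<Union>x\<in>verts G. {{(x, j), (x, l)} | j l. 1 \<le> j \<and> j < l \<and> l \<le> k x})\<rparr>"

lemma vertex_decomposable_iff:
  "vertex_decomposable G \<longleftrightarrow>
     well_covered G \<and> (edges G = {} \<or>
       (\<exists>x\<in>verts G. vertex_decomposable (delete_verts G {x}) \<and>
                     vertex_decomposable (delete_verts G (closed_nbhd G x))))"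
  by (subst vertex_decomposable.simps) auto

lemma fin_simple_graph_delete_verts:
  "fin_simple_graph G \<Longrightarrow> fin_simple_graph (delete_verts G S)"
  by (auto simp: fin_simple_graph_def delete_verts_def)

lemma fin_simple_graph_attach_cliques:
  assumes G: "fin_simple_graph G" and k: "\<And>x. x \<in> verts G \<Longrightarrow> k x \<ge> 2"
  shows "fin_simple_graph (attach_cliques G k)"
proof -
  have "{(x, j). x \<in> verts G \<and> 1 \<le> j \<and> j \<le> k x} = Sigma (verts G) (\<lambda>x. {1..k x})"
    by auto
  moreover have "finite (Sigma (verts G) (\<lambda>x. {1..k x}))"
    using G by (auto simp: fin_simple_graph_def)
  ultimately have fin: "finite (verts (attach_cliques G k))"
    by (simp add: attach_cliques_def)
  have "x \<in> verts G \<and> y \<in> verts G \<and> x \<noteq> y \<and> 1 \<le> k x \<and> 1 \<le> k y" if "{x, y} \<in> edges G" for x y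
  proof -
    have *: "{x, y} \<subseteq> verts G" "card {x, y} = 2"
      using G that by (auto simp: fin_simple_graph_def)
    then have "x \<noteq> y" by auto
    with * k[of x] k[of y] show ?thesis by auto
  qed
  then show ?thesis
    using fin unfolding fin_simple_graph_def by (fastforce simp: attach_cliques_def)
qed

end

theory Submission
  imports Defs
begin

text \<open>Consider graphs whose vertices are partitioned into cliques, each containing a vertex with no
  neighbours outside its clique. Every maximal independent set meets each clique exactly once, so
  such graphs are well-covered. If a clique contains such a vertex \<open>s\<close>, any other vertex \<open>x\<close> of the
  clique is shedding: deleting \<open>x\<close> leaves \<open>s\<close> in its clique, and deleting the closed neighbourhood of
  \<open>x\<close> removes one clique entirely but touches the special vertex of no other clique. The graph with
  attached cliques is of this kind, with special vertices \<open>(x, 2)\<close>.\<close>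

text \<open>Inside a simplicial partition the closed neighbourhood of \<open>s\<close> is exactly
  its fibre, a clique, so \<open>s\<close> is a simplicial vertex in the usual sense.\<close>

definition simplicial_wrt :: "'v ugraph \<Rightarrow> ('v \<Rightarrow> 'c) \<Rightarrow> 'v \<Rightarrow> bool" where
  "simplicial_wrt H f s \<longleftrightarrow> s \<in> verts H \<and> (\<forall>v. {s, v} \<in> edges H \<longrightarrow> f v = f s)"

text \<open>The cliques of the partition are the fibres of \<open>f\<close>.\<close>

definition simplicial_partition :: "'v ugraph \<Rightarrow> ('v \<Rightarrow> 'c) \<Rightarrow> bool" where
  "simplicial_partition H f \<longleftrightarrow> fin_simple_graph H \<and>
     (\<forall>u\<in>verts H. \<forall>v\<in>verts H. u \<noteq> v \<and> f u = f v \<longrightarrow> {u, v} \<in> edges H) \<and>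
     (\<forall>u\<in>verts H. \<exists>s. simplicial_wrt H f s \<and> f s = f u)"

lemma fin_simple_graph_edgeD:
  assumes "fin_simple_graph H" "{u, v} \<in> edges H"
  shows "u \<in> verts H" "v \<in> verts H" "u \<noteq> v"
proof -
  have "{u, v} \<subseteq> verts H" "card {u, v} = 2"
    using assms unfolding fin_simple_graph_def by blast+
  then show "u \<in> verts H" "v \<in> verts H" "u \<noteq> v"
    by auto
qed

lemma simplicial_wrt_delete_verts:
  "simplicial_wrt H f s \<Longrightarrow> s \<notin> S \<Longrightarrow> simplicial_wrt (delete_verts H S) f s"
  by (auto simp: simplicial_wrt_def delete_verts_def)

text \<open>Edges between surviving vertices persist, so only the special vertices are at risk; a
  fibre deleted entirely imposes no condition.\<close>

lemma simplicial_partition_delete_verts: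
  assumes "simplicial_partition H f"
    and "\<And>u. u \<in> verts H - S \<Longrightarrow> \<exists>s. simplicial_wrt H f s \<and> f s = f u \<and> s \<notin> S"
  shows "simplicial_partition (delete_verts H S) f"
  unfolding simplicial_partition_def
proof (intro conjI ballI impI)
  show "fin_simple_graph (delete_verts H S)"
    using assms(1) by (simp add: simplicial_partition_def fin_simple_graph_delete_verts)
next
  fix u v
  assume "u \<in> verts (delete_verts H S)" "v \<in> verts (delete_verts H S)" "u \<noteq> v \<and> f u = f v"
  then show "{u, v} \<in> edges (delete_verts H S)"
    using assms(1) by (auto simp: simplicial_partition_def delete_verts_def)
next
  fix u
  assume "u \<in> verts (delete_verts H S)"
  then have "u \<in> verts H - S"
    by (simp add: delete_verts_def)
  then show "\<exists>s. simplicial_wrt (delete_verts H S) f s \<and> f s = f u"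
    using assms(2) simplicial_wrt_delete_verts by metis
qed

text \<open>\<open>f\<close> maps \<open>S\<close> bijectively onto the labels of the fibres: two
  vertices of \<open>S\<close> in one fibre would be adjacent, and a fibre missed by
  \<open>S\<close> would allow its special vertex to be added.\<close>

lemma card_maximal_independent_set:
  assumes H: "simplicial_partition H f" and S: "maximal_independent_set H S"
  shows "card S = card (f ` verts H)"
proof -
  have ind: "S \<subseteq> verts H" "\<And>u v. u \<in> S \<Longrightarrow> v \<in> S \<Longrightarrow> {u, v} \<notin> edges H"
    using S by (auto simp: maximal_independent_set_def independent_set_def)
  have simple: "fin_simple_graph H"
    using H by (simp add: simplicial_partition_def)
  have "inj_on f S"
    using H ind unfolding simplicial_partition_def inj_on_def by blast
  moreover have "f u \<in> f ` S" if u: "u \<in> verts H" for u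
  proof (rule ccontr)
    assume none: "f u \<notin> f ` S"
    obtain s where s: "simplicial_wrt H f s" "f s = f u"
      using H u unfolding simplicial_partition_def by blast
    have "{s, v} \<notin> edges H" if "v \<in> S" for v
      using s none that unfolding simplicial_wrt_def by (metis image_eqI)
    moreover from this have "{v, s} \<notin> edges H" if "v \<in> S" for v
      using that by (metis insert_commute)
    \<comment> \<open>\<open>independent_set\<close> also tests pairs with equal members, so a loop
      at \<open>s\<close> must be excluded.\<close>
    moreover have "{s, s} \<notin> edges H"
      using fin_simple_graph_edgeD(3)[OF simple] by blast
    ultimately have "independent_set H (insert s S)"
      using ind s unfolding independent_set_def simplicial_wrt_def by blast
    then have "insert s S = S"
      using S unfolding maximal_independent_set_def by blast
    then show False
      using none s by (metis image_eqI insertI1)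
  qed
  then have "f ` S = f ` verts H"
    using ind(1) by blast
  ultimately show ?thesis
    by (metis card_image)
qed

lemma well_covered_simplicial_partition:
  "simplicial_partition H f \<Longrightarrow> well_covered H"
  by (simp add: well_covered_def card_maximal_independent_set)

lemma simplicial_partition_delete_vertex:
  assumes "simplicial_partition H f" "simplicial_wrt H f s" "s \<noteq> x" "f s = f x"
  shows "simplicial_partition (delete_verts H {x}) f"
proof (rule simplicial_partition_delete_verts[OF assms(1)])
  fix u
  assume "u \<in> verts H - {x}"
  then obtain t where "simplicial_wrt H f t" "f t = f u"
    using assms(1) unfolding simplicial_partition_def by blast
  \<comment> \<open>If \<open>t\<close> is \<open>x\<close> itself, the given \<open>s\<close> takes
    over as special vertex of that fibre.\<close>
  then show "\<exists>s. simplicial_wrt H f s \<and> f s = f u \<and> s \<notin> {x}"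
    using assms by (cases "t = x") auto
qed

text \<open>The fibre of \<open>x\<close> is a clique and disappears entirely. The special vertex of
  any other fibre is not adjacent to \<open>x\<close>, so it survives.\<close>

lemma simplicial_partition_delete_closed_nbhd:
  assumes H: "simplicial_partition H f" and x: "x \<in> verts H"
  shows "simplicial_partition (delete_verts H (closed_nbhd H x)) f"
proof (rule simplicial_partition_delete_verts[OF H])
  fix u
  assume u: "u \<in> verts H - closed_nbhd H x"
  then have "u \<in> verts H" "x \<noteq> u" "{x, u} \<notin> edges H"
    by (auto simp: closed_nbhd_def nbhd_def)
  then have "f u \<noteq> f x"
    using H x unfolding simplicial_partition_def by metis
  moreover obtain t where t: "simplicial_wrt H f t" "f t = f u"
    using H u unfolding simplicial_partition_def by blast
  ultimately have "t \<noteq> x" "{t, x} \<notin> edges H"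
    unfolding simplicial_wrt_def by metis+
  then have "t \<notin> closed_nbhd H x"
    by (simp add: closed_nbhd_def nbhd_def insert_commute[of x t])
  with t show "\<exists>s. simplicial_wrt H f s \<and> f s = f u \<and> s \<notin> closed_nbhd H x"
    by blast
qed

text \<open>Induction on the number of vertices works for this class because both deletions at a
  suitable \<open>x\<close> stay inside it, whereas a graph with attached cliques need not keep its
  form.\<close>

lemma vertex_decomposable_simplicial_partition:
  "simplicial_partition H f \<Longrightarrow> vertex_decomposable H"
proof (induction "card (verts H)" arbitrary: H rule: less_induct)
  case less
  note H = \<open>simplicial_partition H f\<close>
  have simple: "fin_simple_graph H" and fin: "finite (verts H)"
    using H by (auto simp: simplicial_partition_def fin_simple_graph_def)
  show ?case
  proof (cases "edges H = {}")
    case True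
    then show ?thesis
      using well_covered_simplicial_partition[OF H] by (intro no_edges)
  next
    case False
    then obtain u v where uv: "{u, v} \<in> edges H"
      using simple unfolding fin_simple_graph_def by (metis card_2_iff ex_in_conv)
    note V = fin_simple_graph_edgeD[OF simple uv]
    obtain s where s: "simplicial_wrt H f s" "f s = f u"
      using H V unfolding simplicial_partition_def by blast
    \<comment> \<open>The edge gives the fibre of \<open>s\<close> a second vertex: \<open>u\<close>
      if \<open>s\<close> differs from it, otherwise \<open>v\<close>, since all neighbours of a
      special vertex share its fibre.\<close>
    have "\<exists>x\<in>verts H. s \<noteq> x \<and> f s = f x"
    proof (cases "s = u")
      case True
      then have "f v = f s"
        using s uv by (simp add: simplicial_wrt_def)
      then show ?thesis
        using V True by metis
    qed (use V s in auto)
    then obtain x where x: "x \<in> verts H" "s \<noteq> x" "f s = f x"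
      by blast
    \<comment> \<open>Serves both deletions, since each of them removes \<open>x\<close>.\<close>
    have smaller: "card (verts (delete_verts H S)) < card (verts H)" if "x \<in> S" for S
      using fin x that by (intro psubset_card_mono) (auto simp: delete_verts_def)
    show ?thesis
    proof (rule shed)
      show "well_covered H"
        using H by (rule well_covered_simplicial_partition)
      show "x \<in> verts H"
        by fact
      show "vertex_decomposable (delete_verts H {x})"
        using less.hyps[OF smaller simplicial_partition_delete_vertex[OF H s(1) x(2,3)]] by simp
      show "vertex_decomposable (delete_verts H (closed_nbhd H x))"
        using less.hyps[OF smaller simplicial_partition_delete_closed_nbhd[OF H x(1)]]
        by (simp add: closed_nbhd_def)
    qed
  qed
qed

lemma mem_Shed_simplicial_partition:
  assumes "simplicial_partition H f" "simplicial_wrt H f s" "x \<in> verts H" "s \<noteq> x" "f s = f x"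
  shows "x \<in> Shed H"
  using vertex_decomposable_simplicial_partition[OF simplicial_partition_delete_vertex[OF assms(1,2,4,5)]]
    vertex_decomposable_simplicial_partition[OF simplicial_partition_delete_closed_nbhd[OF assms(1,3)]]
    assms(3)
  by (simp add: Shed_def)

lemma attach_cliques_clique_edge:
  assumes "(x, i) \<in> verts (attach_cliques G k)" "(x, j) \<in> verts (attach_cliques G k)" "i \<noteq> j"
  shows "{(x, i), (x, j)} \<in> edges (attach_cliques G k)"
proof -
  have "{{(x, i), (x, j)} | i j. 1 \<le> i \<and> i < j \<and> j \<le> k x} \<subseteq> edges (attach_cliques G k)"
    using assms(1) by (auto simp: attach_cliques_def)
  moreover have "{(x, i), (x, j)} \<in> {{(x, i), (x, j)} | i j. 1 \<le> i \<and> i < j \<and> j \<le> k x}"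
  proof (cases "i < j")
    case True
    then show ?thesis
      using assms by (auto simp: attach_cliques_def)
  next
    case False
    \<comment> \<open>Clique edges are listed with the smaller index first, so the pair is turned
      around.\<close>
    then have "{(x, i), (x, j)} = {(x, j), (x, i)} \<and> 1 \<le> j \<and> j < i \<and> i \<le> k x"
      using assms by (auto simp: attach_cliques_def)
    then show ?thesis
      by blast
  qed
  ultimately show ?thesis
    by blast
qed

text \<open>Edges between different cliques join only vertices of index 1, so \<open>(x, 2)\<close>
  sees nothing outside its own clique.\<close>

lemma simplicial_wrt_attach_cliques:
  assumes "x \<in> verts G" "k x \<ge> 2"
  shows "simplicial_wrt (attach_cliques G k) fst (x, 2)"
  using assms by (auto simp: simplicial_wrt_def attach_cliques_def doubleton_eq_iff)

lemma simplicial_partition_attach_cliques: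
  assumes "fin_simple_graph G" and "\<And>x. x \<in> verts G \<Longrightarrow> k x \<ge> 2"
  shows "simplicial_partition (attach_cliques G k) fst"
  unfolding simplicial_partition_def
proof (intro conjI ballI impI)
  show "fin_simple_graph (attach_cliques G k)"
    using assms by (rule fin_simple_graph_attach_cliques)
next
  fix u v
  assume "u \<in> verts (attach_cliques G k)" "v \<in> verts (attach_cliques G k)" "u \<noteq> v \<and> fst u = fst v"
  then show "{u, v} \<in> edges (attach_cliques G k)"
    using attach_cliques_clique_edge by (metis prod.collapse)
next
  fix u
  assume "u \<in> verts (attach_cliques G k)"
  then have "fst u \<in> verts G"
    by (auto simp: attach_cliques_def)
  then show "\<exists>s. simplicial_wrt (attach_cliques G k) fst s \<and> fst s = fst u"
    using assms(2) simplicial_wrt_attach_cliques by (metis fst_conv)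
qed

theorem theorem3p1:
  fixes G :: "'a ugraph" and k :: "'a \<Rightarrow> nat"
  assumes "fin_simple_graph G"
    and "\<And>x. x \<in> verts G \<Longrightarrow> k x \<ge> 2"
  shows "vertex_decomposable (attach_cliques G k) \<and>
         dominating_set (attach_cliques G k) (Shed (attach_cliques G k))"
proof -
  let ?H = "attach_cliques G k"
  have H: "simplicial_partition ?H fst"
    using assms by (rule simplicial_partition_attach_cliques)
  have "\<exists>d\<in>Shed ?H. {v, d} \<in> edges ?H" if v: "v \<in> verts ?H - Shed ?H" for v
  proof -
    obtain x j where xj: "v = (x, j)" "x \<in> verts G"
      using v by (auto simp: attach_cliques_def)
    then have x1: "(x, 1) \<in> verts ?H"
      using assms(2)[of x] by (simp add: attach_cliques_def)
    \<comment> \<open>\<open>(x, 2)\<close> is the special vertex that makes \<open>(x, 1)\<close>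
      shedding, so every attached clique contains a shedding vertex.\<close>
    have shed1: "(x, 1) \<in> Shed ?H"
      using mem_Shed_simplicial_partition[OF H simplicial_wrt_attach_cliques x1] xj assms(2) by simp
    \<comment> \<open>\<open>v\<close> is not shedding but \<open>(x, 1)\<close> is, so they are
      distinct members of one clique.\<close>
    then have "j \<noteq> 1"
      using v xj by auto
    then have "{v, (x, 1)} \<in> edges ?H"
      using attach_cliques_clique_edge[OF _ x1] v xj by simp
    then show ?thesis
      using shed1 by blast
  qed
  moreover have "Shed ?H \<subseteq> verts ?H"
    by (auto simp: Shed_def)
  ultimately show ?thesis
    using vertex_decomposable_simplicial_partition[OF H] by (simp add: dominating_set_def)
qed

end
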